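(* Let $w^0,w^1,w^2,\dots:\mathbb{I}\to[0,1]$ be weight functions, let $\boldsymbol{v}^0,\boldsymbol{v}^1,\boldsymbol{v}^2,\dots$ be vectors in $\mathbb{R}^n$, let $x_*^0\in\mathbb{R}^n$ be arbitrary, and let $x_*^{k+1}=\left(\sum_{\iota\in\mathbb{I}}w^k(\iota)P[\iota](x_*^k)\right)+\boldsymbol{v}^k$ for every $k\ge 0$. Suppose the series $\sum_{k=0}^\infty\|\boldsymbol{v}^k\|$ converges. Then: 1. If $\bigcap\mathcal{C}$ is an $n$-dimensional subset of $\mathbb{R}^n$ (i.e., contains an $n$-dimensional simplex) or $\mathbf{UASC}(\mathcal{C})$ holds, then the sequence $x_*^0,x_*^1,x_*^2,\dots$ converges, and its limit lies in $C_j$ for every index $j$ such that $\sum_{k=0}^\infty\sum_{\iota\in\mathbb{I}\langle j\rangle}w^k(\iota)=\infty$. In particular, if $\bigcap\mathcal{C}$ is an $n$-dimensional subset of $\mathbb{R}^n$ or $\mathbf{UASC}(\mathcal{C})$ holds, and $\sum_{k=0}^\infty\sum_{\iota\in\mathbb{I}\langle j\rangle}w^k(\iota)=\infty$ for every index $j$ such that $C_j\neq\mathbb{R}^n$, then $x_*^0,x_*^1,x_*^2,\dots$ converges to a point in $\bigcap\mathcal{C}$. 2. If there exist $f_1,f_2,f_3,\dots\in[0,1]$ with $\sum_{r=1}^\infty f_r=\infty$ and a sequence of nonnegative integers $\kappa_1<\kappa_2<\kappa_3<\dots$ such that (C1) $\sum_{k=\kappa_r}^{\kappa_{r+1}-2}\mathrm{MaxLength}(w^k)\le\frac{1}{f_r}$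 for all $r\in\mathbb{Z}^+$ such that $\kappa_{r+1}\ge\kappa_r+2$ and $f_r>0$, and (C2) for every index $i$ such that $C_i\neq\mathbb{R}^n$, $\max_{\kappa_r\le k<\kappa_{r+1}}\sum_{\iota\in\mathbb{I}\langle i\rangle}\frac{w^k(\iota)}{\mathrm{Pos}(i,\iota)}\ge f_r$ for all sufficiently large $r\in\mathbb{Z}^+$, then the sequence $x_*^0,x_*^1,x_*^2,\dots$ converges to a point in $\bigcap\mathcal{C}$.
   Context: Fix a positive integer $n$ and an infinite sequence $C_1,C_2,C_3,\dots$ of closed convex subsets of $\mathbb{R}^n$ such that $\bigcap_{i=1}^\infty C_i\neq\emptyset$ and at least one $C_i$ is not $\mathbb{R}^n$. Write $\mathcal{C}=\{C_i\mid 1\le i<\infty\}$, so $\bigcap\mathcal{C}=\bigcap_{i=1}^\infty C_i$. For $q\in\mathbb{R}^n$ and nonempty $Z\subseteq\mathbb{R}^n$, $d(q,Z)=\inf_{z\in Z}\|q-z\|$ (Euclidean norm). An index is a positive integer. For each index $j$, $P_j:\mathbb{R}^n\to C_j$ maps each $q$ to the unique point of $C_j$ closest to $q$. The condition $\mathbf{UASC}(\mathcal{C})$ is: $d\left(p,\bigcup\{C\in\mathcal{C}\mid p\notin C\}\right)>0$ for all $p\in\mathbb{R}^n\setminus\bigcap\mathcal{C}$. $\mathbb{I}$ is the set of all nonempty finite sequences of indices (repetitions allowed); its members are called index vectors. For $\iota=(\iota_1,\dots,\iota_m)\in\mathbb{I}$, $P[\iota]=P_{\iota_m}\circ P_{\iota_{m-1}}\circ\dots\circ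 P_{\iota_1}$ and $\mathrm{Length}(\iota)=m$. For an index $i$, $\mathbb{I}\langle i\rangle$ is the set of index vectors in which $i$ occurs; for $\iota\in\mathbb{I}\langle i\rangle$, $\mathrm{Pos}(i,\iota)$ is the least $j$ with $\iota_j=i$. A weight function is a function $w:\mathbb{I}\to[0,1]$ with finite support such that $\sum_{\iota\in\mathbb{I}}w(\iota)=1$. For a weight function $w$, $\mathrm{MaxLength}(w)=\max\{\mathrm{Length}(\iota)\mid\iota\in\mathbb{I},\ w(\iota)>0\}$. *)

theory Defs
  imports "HOL-Analysis.Analysis"
begin

text \<open>
  Indices are the positive natural numbers; a sequence \<open>C\<^sub>1, C\<^sub>2, \<dots>\<close> is a function on
  \<open>nat\<close> whose value at \<open>0\<close> is never used.
\<close>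

definition family :: "(nat \<Rightarrow> (real ^ 'n) set) \<Rightarrow> (real ^ 'n) set set"
  where "family C = C ` {1..}"

text \<open>
  In \<open>UASC\<close> the value \<open>infdist p {} = 0\<close> plays no role: for \<open>p \<notin> \<Inter>\<C>\<close> the union is
  nonempty as soon as all members of \<open>\<C>\<close> are nonempty.
\<close>

definition UASC :: "(real ^ 'n) set set \<Rightarrow> bool"
  where "UASC \<C> \<longleftrightarrow> (\<forall>p. p \<notin> \<Inter>\<C> \<longrightarrow> infdist p (\<Union>{D \<in> \<C>. p \<notin> D}) > 0)"

definition full_dimensional :: "(real ^ 'n) set \<Rightarrow> bool"
  where "full_dimensional S \<longleftrightarrow> (\<exists>T. int CARD('n) simplex T \<and> T \<subseteq> S)"

definition index_vectors :: "nat list set"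
  where "index_vectors = {\<iota>. \<iota> \<noteq> [] \<and> (\<forall>i \<in> set \<iota>. 1 \<le> i)}"

definition index_vectors_with :: "nat \<Rightarrow> nat list set"
  where "index_vectors_with i = {\<iota> \<in> index_vectors. i \<in> set \<iota>}"

text \<open>Positions are counted from 1, whereas list indexing starts at 0.\<close>

definition Pos :: "nat \<Rightarrow> nat list \<Rightarrow> nat"
  where "Pos i \<iota> = (LEAST j. 1 \<le> j \<and> j \<le> length \<iota> \<and> \<iota> ! (j - 1) = i)"

text \<open>\<open>fold\<close> applies the projection of the first entry of \<open>\<iota>\<close> first.\<close>

definition proj_seq :: "(nat \<Rightarrow> (real ^ 'n) set) \<Rightarrow> nat list \<Rightarrow> real ^ 'n \<Rightarrow> real ^ 'n"
  where "proj_seq C \<iota> = fold (\<lambda>i. closest_point (C i)) \<iota>"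

text \<open>
  Values outside \<open>index_vectors\<close> are ignored throughout. Since \<open>sum\<close> over an infinite set
  is \<open>0\<close> by convention, all sums over sets of index vectors weighted by \<open>w\<close> are taken over
  the part of the set lying in the finite support of \<open>w\<close>.
\<close>

definition support :: "(nat list \<Rightarrow> real) \<Rightarrow> nat list set"
  where "support w = {\<iota> \<in> index_vectors. w \<iota> \<noteq> 0}"

definition weight_function :: "(nat list \<Rightarrow> real) \<Rightarrow> bool"
  where "weight_function w \<longleftrightarrow>
    (\<forall>\<iota> \<in> index_vectors. 0 \<le> w \<iota> \<and> w \<iota> \<le> 1) \<and>
    finite (support w) \<and> (\<Sum>\<iota>\<in>support w. w \<iota>) = 1"

definition MaxLength :: "(nat list \<Rightarrow> real) \<Rightarrow> nat"
  where "MaxLength w = Max (length ` {\<iota> \<in> index_vectors. w \<iota> > 0})"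

definition series_diverges_to_infinity :: "(nat \<Rightarrow> real) \<Rightarrow> bool"
  where "series_diverges_to_infinity a \<longleftrightarrow>
    filterlim (\<lambda>N. \<Sum>k<N. a k) at_top sequentially"

definition total_weight :: "(nat list \<Rightarrow> real) \<Rightarrow> nat \<Rightarrow> real"
  where "total_weight w i = (\<Sum>\<iota>\<in>support w \<inter> index_vectors_with i. w \<iota>)"

definition pos_weight :: "(nat list \<Rightarrow> real) \<Rightarrow> nat \<Rightarrow> real"
  where "pos_weight w i =
    (\<Sum>\<iota>\<in>support w \<inter> index_vectors_with i. w \<iota> / real (Pos i \<iota>))"

end

theory Submission
  imports Defs
begin

text \<open>
  Projecting onto a convex set that contains \<open>z\<close> decreases the squared distance to \<open>z\<close> by at least
  the squared step length. Chained along an index vector, averaged with the weights and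
  telescoped over all iterations, this gives two facts. The distances to every common
  point \<open>z\<close> are almost decreasing: they grow at most by the summable norms of the perturbations
  (\<open>quasi_fejer\<close>). And the mean energies, that is, the averaged sums of squared steps, are summable
  (\<open>summable_mean_energy\<close>). By the first fact the iterates are bounded, and it is enough to find one limit
  point in the intersection to conclude that they converge to it (\<open>tendsto_of_cluster_point\<close>).

  If the intersection contains a ball around \<open>z\<close>, the decrease even dominates a multiple of the
  step length, so the iterates have finite total displacement and converge
  (\<open>full_dimensional_convergence\<close>). Under \<open>UASC\<close>, let \<open>p\<close> be a limit point outside the intersection.
  The sets that miss \<open>p\<close> keep a positive distance from it. Near \<open>p\<close>, index vectors therefore either
  do not move away from \<open>p\<close> or spend a fixed amount of energy. As the energy is
  summable, the iterates cannot escape from \<open>p\<close> and converge to it (\<open>UASC_convergence\<close>). In both cases, if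
  the limit were outside \<open>C j\<close>, every index vector using \<open>j\<close> would eventually cost a fixed
  amount, so the total weight of \<open>j\<close> would be finite (\<open>total_weight_not_diverges\<close>).

  For the block conditions, let \<open>E\<close> be the energy spent in block \<open>r\<close>. By Cauchy--Schwarz, both the
  distance to \<open>C i\<close> at a suitable time in the block and the displacement, apart from
  perturbations, since the start of the block are at most \<open>sqrt (E / f r)\<close>
  (\<open>infdist_block_start_le\<close>). The energies are summable and the \<open>f r\<close> are not, so \<open>E / f r\<close> tends
  to \<open>0\<close> along some blocks; the iterates at their starts have a limit point, which lies in every \<open>C i\<close>
  (\<open>block_convergence\<close>).
\<close>

section \<open>Sequences, series and weighted means\<close>

text \<open>
  The difference of the two sides is the weighted variance of \<open>a\<close>.
\<close>

lemma weighted_mean_square_le: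
  fixes w a :: "'a \<Rightarrow> real"
  assumes "\<And>i. i \<in> S \<Longrightarrow> 0 \<le> w i" and one: "sum w S = 1"
  shows "(\<Sum>i\<in>S. w i * a i)\<^sup>2 \<le> (\<Sum>i\<in>S. w i * (a i)\<^sup>2)"
proof -
  define m where "m = (\<Sum>i\<in>S. w i * a i)"
  have "0 \<le> (\<Sum>i\<in>S. w i * (a i - m)\<^sup>2)"
    by (intro sum_nonneg mult_nonneg_nonneg assms) auto
  also have "\<dots> = (\<Sum>i\<in>S. w i * (a i)\<^sup>2 - 2 * m * (w i * a i) + m\<^sup>2 * w i)"
    by (intro sum.cong) (auto simp: power2_eq_square algebra_simps)
  also have "\<dots> = (\<Sum>i\<in>S. w i * (a i)\<^sup>2) - m\<^sup>2"
    by (simp add: sum.distrib sum_subtractf flip: sum_distrib_left m_def)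
       (simp add: one power2_eq_square)
  finally show ?thesis by (simp add: m_def)
qed

lemma eventually_le_summable_not_diverges:
  assumes "\<forall>\<^sub>F k in sequentially. a k \<le> b k" and "\<And>k. 0 \<le> a k" and "summable b"
  shows "\<not> series_diverges_to_infinity a"
proof
  assume "series_diverges_to_infinity a"
  then have "filterlim (\<lambda>N. \<Sum>k<N. a k) at_infinity sequentially"
    unfolding series_diverges_to_infinity_def by (rule filterlim_at_top_imp_at_infinity)
  moreover have "summable a"
    using assms by (intro summable_comparison_test_ev[of a b]) (auto elim!: eventually_mono)
  then have "(\<lambda>N. \<Sum>k<N. a k) \<longlonglongrightarrow> suminf a" by (rule summable_LIMSEQ)
  ultimately show False
    using not_tendsto_and_filterlim_at_infinity[of sequentially] by auto
qed

text \<open>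
  Otherwise \<open>f\<close> would be dominated by \<open>E / \<epsilon>\<close> from \<open>N\<close> on, and its series would converge.
\<close>

lemma frequently_summable_le_diverging:
  fixes E f :: "nat \<Rightarrow> real"
  assumes "summable E" and "\<And>r. 0 \<le> E r" and "\<And>r. 0 \<le> f r"
    and "series_diverges_to_infinity f" and "\<epsilon> > 0"
  shows "\<exists>r\<ge>N. f r > 0 \<and> E r \<le> \<epsilon> * f r"
proof (rule ccontr)
  assume neg: "\<not> ?thesis"
  have "f r \<le> E r / \<epsilon>" if "r \<ge> N" for r
  proof (cases "f r > 0")
    case True
    then have "\<epsilon> * f r < E r" using neg that by force
    then show ?thesis using \<open>\<epsilon> > 0\<close> by (simp add: field_simps)
  next
    case False
    then show ?thesis using assms(2)[of r] \<open>\<epsilon> > 0\<close> by (simp add: divide_nonneg_pos order_trans[of _ 0])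
  qed
  then have "\<forall>\<^sub>F r in sequentially. f r \<le> E r / \<epsilon>"
    by (auto simp: eventually_at_top_linorder)
  moreover have "summable (\<lambda>r. E r / \<epsilon>)" using assms(1) by (rule summable_divide)
  ultimately have "\<not> series_diverges_to_infinity f"
    using assms(3) by (intro eventually_le_summable_not_diverges)
  then show False using assms(4) by contradiction
qed

lemma summable_block_sums:
  fixes e :: "nat \<Rightarrow> real"
  assumes "strict_mono K" "summable e" "\<And>k. 0 \<le> e k"
  shows "summable (\<lambda>r. \<Sum>k\<in>{K r..<K (Suc r)}. e k)"
proof (rule summableI_nonneg_bounded)
  fix n
  have mono: "K m \<le> K n" if "m \<le> n" for m n :: nat
    using assms(1) that by (simp add: strict_mono_less_eq)
  have "(\<Sum>r<n. \<Sum>k\<in>{K r..<K (Suc r)}. e k) = (\<Sum>k\<in>{K 0..<K n}. e k)"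
  proof (induction n)
    case (Suc n)
    then show ?case by (simp add: sum.atLeastLessThan_concat mono)
  qed simp
  also have "\<dots> \<le> suminf e" by (intro sum_le_suminf assms) auto
  finally show "(\<Sum>r<n. \<Sum>k\<in>{K r..<K (Suc r)}. e k) \<le> suminf e" .
qed (intro sum_nonneg assms)

text \<open>
  The increments bound \<open>d\<close> only where \<open>d\<close> is already at most \<open>\<eta>\<close>. Once \<open>d\<close> is tiny at a time after
  which the remaining increments have tiny sum, it can never climb past \<open>\<eta>\<close>, so the bound stays
  applicable forever. The local form is what a limit point outside the intersection
  requires: distances to such a point are controlled only near it.
\<close>

lemma tendsto_zero_of_almost_decreasing:
  fixes d s :: "nat \<Rightarrow> real"
  assumes nonneg: "\<And>k. 0 \<le> d k" "\<And>k. 0 \<le> s k" and "summable s" and "\<eta> > 0"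
    and step: "\<And>k. d k \<le> \<eta> \<Longrightarrow> d (Suc k) \<le> d k + s k"
    and small: "\<And>\<epsilon> N. \<epsilon> > 0 \<Longrightarrow> \<exists>k\<ge>N. d k < \<epsilon>"
  shows "d \<longlonglongrightarrow> 0"
proof (rule LIMSEQ_I)
  fix e :: real assume "e > 0"
  define \<epsilon> where "\<epsilon> = min e \<eta>"
  have "\<epsilon> > 0" using \<open>e > 0\<close> \<open>\<eta> > 0\<close> by (simp add: \<epsilon>_def)
  obtain N where N: "\<And>m n. m \<ge> N \<Longrightarrow> norm (sum s {m..<n}) < \<epsilon> / 2"
    using \<open>summable s\<close> \<open>\<epsilon> > 0\<close> unfolding summable_Cauchy by (meson half_gt_zero)
  obtain K where K: "K \<ge> N" "d K < \<epsilon> / 2" using small \<open>\<epsilon> > 0\<close> half_gt_zero by blast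
  have "d (K + n) \<le> d K + sum s {K..<K + n}" for n
  proof (induction n)
    case (Suc n)
    have "norm (sum s {K..<K + n}) < \<epsilon> / 2" using N K by blast
    then have "d (K + n) \<le> \<eta>" using Suc K by (auto simp: \<epsilon>_def)
    then show ?case using Suc step[of "K + n"] by simp
  qed simp
  moreover have "sum s {K..<n} < \<epsilon> / 2" for n using N[OF K(1), of n] by auto
  ultimately have "d (K + n) < \<epsilon>" for n using K(2) by (smt (verit) field_sum_of_halves)
  then have "norm (d n - 0) < e" if "n \<ge> K" for n
    using that nonneg(1)[of n] \<open>\<And>n. d (K + n) < \<epsilon>\<close>[of "n - K"] by (simp add: \<epsilon>_def)
  then show "\<exists>no. \<forall>n\<ge>no. norm (d n - 0) < e" by blast
qed

section \<open>Simplices and closest points\<close>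

lemma simplex_interior_nonempty:
  fixes T :: "(real ^ 'n) set"
  assumes "int CARD('n) simplex T"
  shows "interior T \<noteq> {}"
proof -
  have "aff_dim T = DIM(real ^ 'n)" using assms aff_dim_simplex by force
  moreover from this have "T \<noteq> {}" by auto
  moreover have "convex T" using assms convex_simplex by blast
  ultimately show ?thesis
    by (metis interior_rel_interior_gen rel_interior_eq_empty)
qed

text \<open>
  Moving \<open>z\<close> by \<open>\<rho>\<close> in the direction of the residual \<open>q - p\<close> gives the point of the ball for which
  the obtuse-angle property of projections is strongest. The case \<open>\<rho> = 0\<close> says that the squared
  distance to a point of \<open>S\<close> drops by the squared step length. When \<open>S\<close> contains a proper ball, it
  also drops by a multiple of the step length itself.
\<close>

lemma closest_point_dist_decrease:
  fixes S :: "'a::euclidean_space set" and q z :: 'a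
  assumes "closed S" "convex S" "0 \<le> \<rho>" "cball z \<rho> \<subseteq> S"
  defines "p \<equiv> closest_point S q"
  shows "(dist p z)\<^sup>2 + (dist q p)\<^sup>2 + 2 * \<rho> * dist q p \<le> (dist q z)\<^sup>2"
proof -
  define u where "u = q - p"
  (* sgn 0 = 0, so this covers q = p as well *)
  define z' where "z' = z + \<rho> *\<^sub>R sgn u"
  have "z' \<in> cball z \<rho>" using \<open>0 \<le> \<rho>\<close> by (simp add: z'_def dist_norm norm_sgn)
  then have "z' \<in> S" using assms(4) by blast
  then have "u \<bullet> (z' - p) \<le> 0"
    unfolding u_def p_def using closest_point_dot[OF assms(2,1)] by blast
  moreover have "u \<bullet> sgn u = norm u"
    by (cases "u = 0") (simp_all add: sgn_div_norm power2_norm_eq_inner[symmetric] power2_eq_square)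
  ultimately have "u \<bullet> (z - p) \<le> - \<rho> * norm u"
    by (simp add: z'_def inner_diff_right inner_add_right)
  moreover have "(dist q z)\<^sup>2 = (norm u)\<^sup>2 + (dist p z)\<^sup>2 - 2 * (u \<bullet> (z - p))"
    by (simp add: u_def dist_norm power2_norm_eq_inner inner_commute algebra_simps)
  ultimately show ?thesis by (simp add: u_def dist_norm)
qed

section \<open>Length and energy of a chain of projections\<close>

text \<open>
  Both kinds of decrease are accumulated along the broken line from \<open>q\<close> through its successive
  projections. The gauge \<open>g\<close> turns a step length into a cost, so that its length and its energy (the
  sum of the squared steps) are treated together.
\<close>

primrec path_cost :: "(real \<Rightarrow> real) \<Rightarrow> (nat \<Rightarrow> (real ^ 'n) set) \<Rightarrow> nat list \<Rightarrow> real ^ 'n \<Rightarrow> real" where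
  "path_cost g C [] q = 0"
| "path_cost g C (i # \<iota>) q =
     g (dist q (closest_point (C i) q)) + path_cost g C \<iota> (closest_point (C i) q)"

abbreviation "path_length \<equiv> path_cost (\<lambda>t. t)"
abbreviation "path_energy \<equiv> path_cost (\<lambda>t. t\<^sup>2)"

lemma proj_seq_simps [simp]:
  "proj_seq C [] q = q"
  "proj_seq C (i # \<iota>) q = proj_seq C \<iota> (closest_point (C i) q)"
  by (simp_all add: proj_seq_def)

lemma path_cost_nonneg: "(\<And>t. 0 \<le> t \<Longrightarrow> 0 \<le> g t) \<Longrightarrow> 0 \<le> path_cost g C \<iota> q"
  by (induction \<iota> arbitrary: q) auto

lemma path_cost_scale: "path_cost (\<lambda>t. a * t) C \<iota> q = a * path_length C \<iota> q"
  by (induction \<iota> arbitrary: q) (auto simp: algebra_simps)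

lemma path_cost_take_le:
  "(\<And>t. 0 \<le> t \<Longrightarrow> 0 \<le> g t) \<Longrightarrow> path_cost g C (take m \<iota>) q \<le> path_cost g C \<iota> q"
proof (induction \<iota> arbitrary: q m)
  case (Cons i \<iota>)
  then show ?case by (cases m) (auto intro!: add_nonneg_nonneg path_cost_nonneg)
qed simp

lemma dist_proj_seq_le_path_length: "dist q (proj_seq C \<iota> q) \<le> path_length C \<iota> q"
proof (induction \<iota> arbitrary: q)
  case (Cons i \<iota>)
  show ?case
    using Cons.IH[of "closest_point (C i) q"]
      dist_triangle[of q "proj_seq C \<iota> (closest_point (C i) q)" "closest_point (C i) q"]
    by simp
qed simp

text \<open>
  The Cauchy--Schwarz inequality for the step lengths, one step at a time.
\<close>

lemma path_length_square_le: "(path_length C \<iota> q)\<^sup>2 \<le> length \<iota> * path_energy C \<iota> q"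
proof (induction \<iota> arbitrary: q)
  case (Cons i \<iota>)
  define t where "t = dist q (closest_point (C i) q)"
  define A where "A = path_length C \<iota> (closest_point (C i) q)"
  define S where "S = path_energy C \<iota> (closest_point (C i) q)"
  define n where "n = real (length \<iota>)"
  have IH: "A\<^sup>2 \<le> n * S" using Cons.IH by (simp add: A_def S_def n_def)
  have "(t + A)\<^sup>2 \<le> (n + 1) * (t\<^sup>2 + S)"
  proof (cases "\<iota> = []")
    case False
    then have "n > 0" by (simp add: n_def)
    (* multiplied out, this is the Cauchy--Schwarz gap for one step of length t and n steps of mean A / n *)
    have "0 \<le> (n * t - A)\<^sup>2 / n" using \<open>n > 0\<close> by simp
    also have "\<dots> = n * t\<^sup>2 + A\<^sup>2 / n - 2 * t * A"
      using \<open>n > 0\<close> by (simp add: power2_eq_square field_simps)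
    also have "\<dots> \<le> n * t\<^sup>2 + S - 2 * t * A"
      using IH \<open>n > 0\<close> by (simp add: field_simps)
    finally show ?thesis using IH by (simp add: power2_eq_square algebra_simps)
  qed (simp add: A_def S_def n_def)
  then show ?case by (simp add: t_def A_def S_def n_def add.commute)
qed simp

lemma Pos_props:
  assumes "i \<in> set \<iota>"
  shows "1 \<le> Pos i \<iota>" and "Pos i \<iota> \<le> length \<iota>" and "i \<in> set (take (Pos i \<iota>) \<iota>)"
proof -
  obtain j where j: "j < length \<iota>" "\<iota> ! j = i" using assms by (metis in_set_conv_nth)
  have *: "1 \<le> Pos i \<iota> \<and> Pos i \<iota> \<le> length \<iota> \<and> \<iota> ! (Pos i \<iota> - 1) = i"
    unfolding Pos_def by (rule LeastI[of _ "Suc j"]) (use j in auto)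
  then show "1 \<le> Pos i \<iota>" and "Pos i \<iota> \<le> length \<iota>" by auto
  have "take (Pos i \<iota>) \<iota> ! (Pos i \<iota> - 1) = i" using * by simp
  moreover have "Pos i \<iota> - 1 < length (take (Pos i \<iota>) \<iota>)" using * by simp
  ultimately show "i \<in> set (take (Pos i \<iota>) \<iota>)" by (metis nth_mem)
qed

section \<open>Projections onto a family of convex sets with a common point\<close>

locale convex_family =
  fixes C :: "nat \<Rightarrow> (real ^ 'n) set"
  assumes closed_C: "\<And>i. 1 \<le> i \<Longrightarrow> closed (C i)"
    and convex_C: "\<And>i. 1 \<le> i \<Longrightarrow> convex (C i)"
    and common_point: "\<Inter>(family C) \<noteq> {}"
begin

lemma in_Inter_family: "z \<in> \<Inter>(family C) \<longleftrightarrow> (\<forall>i\<ge>1. z \<in> C i)"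
  by (auto simp: family_def)

lemma in_C: "z \<in> \<Inter>(family C) \<Longrightarrow> 1 \<le> i \<Longrightarrow> z \<in> C i"
  using in_Inter_family by blast

lemma C_nonempty: "1 \<le> i \<Longrightarrow> C i \<noteq> {}"
  using common_point in_Inter_family by blast

lemma proj_in: "1 \<le> i \<Longrightarrow> closest_point (C i) q \<in> C i"
  by (simp add: C_nonempty closed_C closest_point_in_set)

text \<open>
  A decrease that holds for every single projection telescopes along the broken line.
\<close>

lemma path_cost_fejer:
  assumes "\<forall>i\<in>set \<iota>. 1 \<le> i"
    and "\<And>i q. 1 \<le> i \<Longrightarrow> (dist (closest_point (C i) q) z)\<^sup>2
      + g (dist q (closest_point (C i) q)) \<le> (dist q z)\<^sup>2"
  shows "(dist (proj_seq C \<iota> q) z)\<^sup>2 + path_cost g C \<iota> q \<le> (dist q z)\<^sup>2"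
  using assms(1)
proof (induction \<iota> arbitrary: q)
  case (Cons i \<iota>)
  show ?case using Cons.IH[of "closest_point (C i) q"] Cons.prems assms(2)[of i q] by simp
qed simp

lemma energy_fejer:
  assumes "z \<in> C i" "1 \<le> i"
  shows "(dist (closest_point (C i) q) z)\<^sup>2 + (dist q (closest_point (C i) q))\<^sup>2 \<le> (dist q z)\<^sup>2"
  using closest_point_dist_decrease[of "C i" 0 z q] assms closed_C[of i] convex_C[of i]
  by simp

lemma length_fejer:
  assumes "cball z \<rho> \<subseteq> \<Inter>(family C)" "0 \<le> \<rho>" "1 \<le> i"
  shows "(dist (closest_point (C i) q) z)\<^sup>2 + 2 * \<rho> * dist q (closest_point (C i) q) \<le> (dist q z)\<^sup>2"
proof -
  have "cball z \<rho> \<subseteq> C i" using assms in_Inter_family by blast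
  then show ?thesis
    using closest_point_dist_decrease[of "C i" \<rho> z q] assms closed_C[of i] convex_C[of i]
      zero_le_power2[of "dist q (closest_point (C i) q)"] by linarith
qed

lemma proj_seq_nonexpansive:
  assumes "\<forall>i\<in>set \<iota>. 1 \<le> i \<and> p \<in> C i"
  shows "dist (proj_seq C \<iota> q) p \<le> dist q p"
  using assms
proof (induction \<iota> arbitrary: q)
  case (Cons i \<iota>)
  have "p \<in> C i" "1 \<le> i" using Cons.prems by auto
  then have "(dist (closest_point (C i) q) p)\<^sup>2 \<le> (dist q p)\<^sup>2"
    using energy_fejer[of p i q] zero_le_power2[of "dist q (closest_point (C i) q)"] by linarith
  then have "dist (closest_point (C i) q) p \<le> dist q p" by (rule power2_le_imp_le) simp
  then show ?case using Cons.IH[of "closest_point (C i) q"] Cons.prems by auto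
qed simp

text \<open>
  The broken line visits \<open>C j\<close>, so it is at least as long as the distance to this set.
\<close>

lemma infdist_le_path_length:
  assumes "\<forall>i\<in>set \<iota>. 1 \<le> i" "j \<in> set \<iota>"
  shows "infdist q (C j) \<le> path_length C \<iota> q"
  using assms
proof (induction \<iota> arbitrary: q)
  case (Cons i \<iota>)
  show ?case
  proof (cases "i = j")
    case True
    then have "infdist q (C j) \<le> dist q (closest_point (C i) q)"
      using Cons.prems proj_in by (intro infdist_le) auto
    then show ?thesis using path_cost_nonneg[of "\<lambda>t. t" C \<iota>] by (simp add: add_increasing2)
  next
    case False
    then show ?thesis
      using Cons.IH[of "closest_point (C i) q"] Cons.prems
        infdist_triangle[of q "C j" "closest_point (C i) q"] by auto
  qed
qed simp

text \<open>
  Cut off after the first visit to \<open>C j\<close>, the broken line has \<open>Pos j \<iota>\<close> steps and length at least the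
  distance to \<open>C j\<close>. Cauchy--Schwarz then gives the energy; this is where the weights
  \<open>1 / Pos j \<iota>\<close> come from.
\<close>

lemma infdist_square_le_Pos_energy:
  assumes "\<forall>i\<in>set \<iota>. 1 \<le> i" "j \<in> set \<iota>"
  shows "(infdist q (C j))\<^sup>2 / Pos j \<iota> \<le> path_energy C \<iota> q"
proof -
  define \<tau> where "\<tau> = take (Pos j \<iota>) \<iota>"
  have \<tau>: "length \<tau> = Pos j \<iota>" "j \<in> set \<tau>" "\<forall>i\<in>set \<tau>. 1 \<le> i" "1 \<le> Pos j \<iota>"
    using Pos_props[OF assms(2)] assms(1) by (auto simp: \<tau>_def dest: in_set_takeD)
  have "(infdist q (C j))\<^sup>2 \<le> (path_length C \<tau> q)\<^sup>2"
    using infdist_le_path_length[OF \<tau>(3,2)] by (intro power_mono) (auto simp: infdist_nonneg)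
  also have "\<dots> \<le> Pos j \<iota> * path_energy C \<tau> q"
    using path_length_square_le[of C \<tau> q] \<tau>(1) by simp
  also have "\<dots> \<le> Pos j \<iota> * path_energy C \<iota> q"
    unfolding \<tau>_def by (intro mult_left_mono path_cost_take_le) auto
  finally show ?thesis using \<tau>(4) by (simp add: field_simps)
qed

text \<open>
  Projections onto sets containing \<open>p\<close> keep the point within \<open>\<eta>\<close> of \<open>p\<close>. The first projection
  onto a set missing \<open>p\<close> must then jump at least \<open>\<eta>\<close>, because that set stays \<open>2 * \<eta>\<close> away from \<open>p\<close>.
\<close>

lemma energy_ge_of_far_set:
  assumes far: "\<And>i c. 1 \<le> i \<Longrightarrow> p \<notin> C i \<Longrightarrow> c \<in> C i \<Longrightarrow> 2 * \<eta> \<le> dist p c"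
    and "0 \<le> \<eta>" "dist q p \<le> \<eta>" "\<forall>i\<in>set \<iota>. 1 \<le> i" "j \<in> set \<iota>" "p \<notin> C j"
  shows "\<eta>\<^sup>2 \<le> path_energy C \<iota> q"
  using assms(3-)
proof (induction \<iota> arbitrary: q)
  case (Cons i \<iota>)
  show ?case
  proof (cases "p \<in> C i")
    case True
    then have "dist (closest_point (C i) q) p \<le> dist q p"
      using proj_seq_nonexpansive[of "[i]" p q] Cons.prems by simp
    then show ?thesis
      using Cons.IH[of "closest_point (C i) q"] Cons.prems True by (auto intro: add_increasing)
  next
    case False
    then have "2 * \<eta> \<le> dist p (closest_point (C i) q)"
      using Cons.prems by (intro far[of i] proj_in) auto
    then have "\<eta> \<le> dist q (closest_point (C i) q)"
      using Cons.prems(1) dist_triangle[of p "closest_point (C i) q" q] by (simp add: dist_commute)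
    then have "\<eta>\<^sup>2 \<le> (dist q (closest_point (C i) q))\<^sup>2" using \<open>0 \<le> \<eta>\<close> by (rule power_mono)
    then show ?thesis using path_cost_nonneg[of "\<lambda>t. t\<^sup>2" C \<iota>] by (simp add: add_increasing2)
  qed
qed simp

lemma UASC_far:
  assumes "UASC (family C)" "p \<notin> \<Inter>(family C)"
  obtains \<eta> where "\<eta> > 0" "\<And>i c. 1 \<le> i \<Longrightarrow> p \<notin> C i \<Longrightarrow> c \<in> C i \<Longrightarrow> 2 * \<eta> \<le> dist p c"
proof -
  define U where "U = \<Union>{D \<in> family C. p \<notin> D}"
  have "infdist p U > 0" using assms by (simp add: UASC_def U_def)
  moreover have "infdist p U \<le> dist p c" if "1 \<le> i" "p \<notin> C i" "c \<in> C i" for i c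
    using that by (intro infdist_le) (auto simp: U_def family_def)
  ultimately show thesis by (intro that[of "infdist p U / 2"]) auto
qed

end

section \<open>Perturbed averages of projections\<close>

locale perturbed_projections = convex_family C for C :: "nat \<Rightarrow> (real ^ 'n) set" +
  fixes w :: "nat \<Rightarrow> nat list \<Rightarrow> real" and v x :: "nat \<Rightarrow> real ^ 'n"
  assumes weights: "\<And>k. weight_function (w k)"
    and iterate: "\<And>k. x (Suc k) = (\<Sum>\<iota>\<in>support (w k). w k \<iota> *\<^sub>R proj_seq C \<iota> (x k)) + v k"
    and summable_v: "summable (\<lambda>k. norm (v k))"
begin

definition mean_cost :: "(real \<Rightarrow> real) \<Rightarrow> nat \<Rightarrow> real" where
  "mean_cost g k = (\<Sum>\<iota>\<in>support (w k). w k \<iota> * path_cost g C \<iota> (x k))"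

abbreviation "mean_energy \<equiv> mean_cost (\<lambda>t. t\<^sup>2)"

lemma finite_support: "finite (support (w k))"
  and sum_weights: "(\<Sum>\<iota>\<in>support (w k). w k \<iota>) = 1"
  using weights[of k] by (auto simp: weight_function_def)

lemma weight_nonneg: "\<iota> \<in> support (w k) \<Longrightarrow> 0 \<le> w k \<iota>"
  using weights[of k] by (auto simp: weight_function_def support_def)

lemma support_indices: "\<iota> \<in> support (w k) \<Longrightarrow> \<forall>i\<in>set \<iota>. 1 \<le> i"
  by (auto simp: support_def index_vectors_def)

lemma mean_cost_nonneg: "(\<And>t. 0 \<le> t \<Longrightarrow> 0 \<le> g t) \<Longrightarrow> 0 \<le> mean_cost g k"
  unfolding mean_cost_def by (intro sum_nonneg mult_nonneg_nonneg weight_nonneg path_cost_nonneg)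

lemma length_le_MaxLength: "\<iota> \<in> support (w k) \<Longrightarrow> length \<iota> \<le> MaxLength (w k)"
proof -
  have "support (w k) = {\<iota> \<in> index_vectors. w k \<iota> > 0}"
    using weights[of k] by (force simp: weight_function_def support_def)
  then show "\<iota> \<in> support (w k) \<Longrightarrow> length \<iota> \<le> MaxLength (w k)"
    unfolding MaxLength_def using finite_support[of k] by (intro Max_ge) auto
qed

lemma dist_iterate_le:
  "dist (x (Suc k)) p \<le> (\<Sum>\<iota>\<in>support (w k). w k \<iota> * dist (proj_seq C \<iota> (x k)) p) + norm (v k)"
proof -
  let ?S = "support (w k)"
  have "x (Suc k) - p = (\<Sum>\<iota>\<in>?S. w k \<iota> *\<^sub>R proj_seq C \<iota> (x k)) - (\<Sum>\<iota>\<in>?S. w k \<iota>) *\<^sub>R p + v k"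
    by (simp add: iterate sum_weights)
  also have "\<dots> = (\<Sum>\<iota>\<in>?S. w k \<iota> *\<^sub>R (proj_seq C \<iota> (x k) - p)) + v k"
    by (simp add: scaleR_sum_left sum_subtractf scaleR_diff_right)
  finally have "dist (x (Suc k)) p \<le> norm (\<Sum>\<iota>\<in>?S. w k \<iota> *\<^sub>R (proj_seq C \<iota> (x k) - p)) + norm (v k)"
    by (simp add: dist_norm norm_triangle_ineq)
  also have "norm (\<Sum>\<iota>\<in>?S. w k \<iota> *\<^sub>R (proj_seq C \<iota> (x k) - p))
      \<le> (\<Sum>\<iota>\<in>?S. norm (w k \<iota> *\<^sub>R (proj_seq C \<iota> (x k) - p)))" by (rule norm_sum)
  also have "\<dots> = (\<Sum>\<iota>\<in>?S. w k \<iota> * dist (proj_seq C \<iota> (x k)) p)"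
    by (intro sum.cong) (auto simp: dist_norm weight_nonneg)
  finally show ?thesis by simp
qed

lemma weighted_sum_le:
  assumes "\<And>\<iota>. \<iota> \<in> support (w k) \<Longrightarrow> f \<iota> \<le> c"
  shows "(\<Sum>\<iota>\<in>support (w k). w k \<iota> * f \<iota>) \<le> c"
proof -
  have "(\<Sum>\<iota>\<in>support (w k). w k \<iota> * f \<iota>) \<le> (\<Sum>\<iota>\<in>support (w k). w k \<iota> * c)"
    by (intro sum_mono mult_left_mono assms weight_nonneg)
  then show ?thesis by (simp add: sum_weights flip: sum_distrib_right)
qed

text \<open>
  The averaged projections move no point away from \<open>z\<close>, hence only the perturbation can increase
  the distance. Iterates are therefore bounded, and a limit point in the intersection is
  already the limit.
\<close>

lemma quasi_fejer:
  assumes "z \<in> \<Inter>(family C)"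
  shows "dist (x (Suc k)) z \<le> dist (x k) z + norm (v k)"
proof -
  have "(\<Sum>\<iota>\<in>support (w k). w k \<iota> * dist (proj_seq C \<iota> (x k)) z) \<le> dist (x k) z"
    using support_indices in_C[OF assms] by (intro weighted_sum_le proj_seq_nonexpansive) auto
  then show ?thesis using dist_iterate_le[of k z] by simp
qed

lemma dist_bounded:
  assumes "z \<in> \<Inter>(family C)"
  shows "dist (x k) z \<le> dist (x 0) z + (\<Sum>k. norm (v k))"
proof -
  have "dist (x k) z \<le> dist (x 0) z + (\<Sum>i<k. norm (v i))"
  proof (induction k)
    case (Suc k)
    then show ?case using quasi_fejer[OF assms, of k] by simp
  qed simp
  also have "(\<Sum>i<k. norm (v i)) \<le> (\<Sum>k. norm (v k))"
    by (intro sum_le_suminf summable_v) auto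
  finally show ?thesis by simp
qed

lemma bounded_iterates: "bounded (range x)"
proof -
  obtain z where "z \<in> \<Inter>(family C)" using common_point by blast
  then show ?thesis using dist_bounded[of z] unfolding bounded_def
    by (intro exI[of _ z]) (auto simp: dist_commute)
qed

text \<open>
  The cost of a step is paid for by the decrease of the squared distance to \<open>z\<close>, up to an error
  proportional to the perturbation. The partial sums of the costs telescope to a
  bounded quantity.
\<close>

lemma summable_mean_cost:
  assumes z: "z \<in> \<Inter>(family C)" and g: "\<And>t. 0 \<le> t \<Longrightarrow> 0 \<le> g t"
    and decrease: "\<And>i q. 1 \<le> i \<Longrightarrow> (dist (closest_point (C i) q) z)\<^sup>2
      + g (dist q (closest_point (C i) q)) \<le> (dist q z)\<^sup>2"
  shows "summable (mean_cost g)"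
proof -
  define B where "B = dist (x 0) z + (\<Sum>k. norm (v k))"
  define a where "a k = (\<Sum>\<iota>\<in>support (w k). w k \<iota> * dist (proj_seq C \<iota> (x k)) z)" for k
  have B: "dist (x k) z \<le> B" for k using dist_bounded[OF z] by (simp add: B_def)
  have step: "mean_cost g k \<le> (dist (x k) z)\<^sup>2 - (dist (x (Suc k)) z)\<^sup>2 + 2 * B * norm (v k)" for k
  proof -
    have "0 \<le> a k" unfolding a_def by (intro sum_nonneg mult_nonneg_nonneg weight_nonneg) auto
    have "(a k)\<^sup>2 \<le> (\<Sum>\<iota>\<in>support (w k). w k \<iota> * (dist (proj_seq C \<iota> (x k)) z)\<^sup>2)"
      unfolding a_def by (intro weighted_mean_square_le weight_nonneg sum_weights)
    then have "(a k)\<^sup>2 + mean_cost g k \<le> (\<Sum>\<iota>\<in>support (w k).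
        w k \<iota> * ((dist (proj_seq C \<iota> (x k)) z)\<^sup>2 + path_cost g C \<iota> (x k)))"
      by (simp add: mean_cost_def sum.distrib distrib_left)
    also have "\<dots> \<le> (dist (x k) z)\<^sup>2"
      by (intro weighted_sum_le path_cost_fejer support_indices decrease)
    finally have 1: "(a k)\<^sup>2 + mean_cost g k \<le> (dist (x k) z)\<^sup>2" .
    moreover have "0 \<le> mean_cost g k" by (intro mean_cost_nonneg g)
    ultimately have "(a k)\<^sup>2 \<le> (dist (x k) z)\<^sup>2" by linarith
    then have "a k \<le> dist (x k) z" by (rule power2_le_imp_le) simp
    define b where "b = dist (x (Suc k)) z"
    have b: "0 \<le> b" "b \<le> B" "b \<le> a k + norm (v k)" "a k \<le> B"
      using B[of "Suc k"] dist_iterate_le[of k z] order_trans[OF \<open>a k \<le> dist (x k) z\<close> B[of k]]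
      by (auto simp: b_def a_def)
    have "b\<^sup>2 \<le> (a k)\<^sup>2 + 2 * B * norm (v k)"
    proof (cases "b \<le> a k")
      case True
      then have "b\<^sup>2 \<le> (a k)\<^sup>2" using b by (intro power_mono) auto
      then show ?thesis using b by (simp add: add_increasing2)
    next
      case False
      have "(b - a k) * (b + a k) \<le> norm (v k) * (2 * B)"
        using b \<open>0 \<le> a k\<close> False by (intro mult_mono) auto
      then show ?thesis by (simp add: power2_eq_square algebra_simps)
    qed
    then show ?thesis using 1 by (simp add: b_def)
  qed
  have "(\<Sum>k<n. mean_cost g k) \<le> (dist (x 0) z)\<^sup>2 - (dist (x n) z)\<^sup>2 + 2 * B * (\<Sum>k<n. norm (v k))" for n
  proof (induction n)
    case (Suc n)
    then show ?case using step[of n] by (simp add: distrib_left)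
  qed simp
  moreover have "(dist (x 0) z)\<^sup>2 - (dist (x n) z)\<^sup>2 + 2 * B * (\<Sum>k<n. norm (v k))
      \<le> (dist (x 0) z)\<^sup>2 + 2 * B * (\<Sum>k. norm (v k))" for n
  proof -
    have "0 \<le> B" using B[of 0] zero_le_dist order_trans by blast
    then have "2 * B * (\<Sum>k<n. norm (v k)) \<le> 2 * B * (\<Sum>k. norm (v k))"
      by (intro mult_left_mono sum_le_suminf summable_v) auto
    then show ?thesis using zero_le_power2[of "dist (x n) z"] by linarith
  qed
  ultimately have "(\<Sum>k<n. mean_cost g k) \<le> (dist (x 0) z)\<^sup>2 + 2 * B * (\<Sum>k. norm (v k))" for n
    by (rule order_trans)
  then show ?thesis by (intro summableI_nonneg_bounded mean_cost_nonneg[OF g])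
qed

lemma summable_mean_energy: "summable mean_energy"
proof -
  obtain z where "z \<in> \<Inter>(family C)" using common_point by blast
  then show ?thesis by (intro summable_mean_cost[of z] energy_fejer in_C) auto
qed

lemma tendsto_of_cluster_point:
  assumes "L \<in> \<Inter>(family C)" and "\<And>\<epsilon> N. \<epsilon> > 0 \<Longrightarrow> \<exists>k\<ge>N. dist (x k) L < \<epsilon>"
  shows "x \<longlonglongrightarrow> L"
proof -
  have "(\<lambda>k. dist (x k) L) \<longlonglongrightarrow> 0"
    using assms quasi_fejer summable_v
    by (intro tendsto_zero_of_almost_decreasing[of _ "\<lambda>k. norm (v k)" 1]) auto
  then show ?thesis by (rule tendsto_dist_iff[THEN iffD2])
qed

lemma mean_cost_ge_total_weight:
  assumes "\<And>t. 0 \<le> t \<Longrightarrow> 0 \<le> g t"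
    and "\<And>\<iota>. \<iota> \<in> support (w k) \<Longrightarrow> j \<in> set \<iota> \<Longrightarrow> c \<le> path_cost g C \<iota> (x k)"
  shows "c * total_weight (w k) j \<le> mean_cost g k"
proof -
  have "c * total_weight (w k) j = (\<Sum>\<iota>\<in>support (w k) \<inter> index_vectors_with j. w k \<iota> * c)"
    by (simp add: total_weight_def sum_distrib_left mult.commute)
  also have "\<dots> \<le> (\<Sum>\<iota>\<in>support (w k) \<inter> index_vectors_with j. w k \<iota> * path_cost g C \<iota> (x k))"
    by (intro sum_mono mult_left_mono assms(2) weight_nonneg) (auto simp: index_vectors_with_def)
  also have "\<dots> \<le> mean_cost g k"
    unfolding mean_cost_def
    by (intro sum_mono2 finite_support mult_nonneg_nonneg weight_nonneg path_cost_nonneg assms(1)) auto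
  finally show ?thesis .
qed

text \<open>
  If every index vector using \<open>j\<close> eventually costs at least \<open>c\<close>, the summable costs bound the total
  weight of \<open>j\<close>. Contrapositively, an index of infinite total weight cannot keep charging a fixed
  price; this puts the limit into \<open>C j\<close>.
\<close>

lemma total_weight_not_diverges:
  assumes "c > 0" "summable (mean_cost g)" "\<And>t. 0 \<le> t \<Longrightarrow> 0 \<le> g t"
    and "\<forall>\<^sub>F k in sequentially. \<forall>\<iota>\<in>support (w k). j \<in> set \<iota> \<longrightarrow> c \<le> path_cost g C \<iota> (x k)"
  shows "\<not> series_diverges_to_infinity (\<lambda>k. total_weight (w k) j)"
proof (rule eventually_le_summable_not_diverges)
  show "\<forall>\<^sub>F k in sequentially. total_weight (w k) j \<le> mean_cost g k / c"
    using assms(4)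
  proof eventually_elim
    case (elim k)
    then have "c * total_weight (w k) j \<le> mean_cost g k"
      by (intro mean_cost_ge_total_weight assms(3)) auto
    then show ?case using \<open>c > 0\<close> by (simp add: field_simps)
  qed
  show "0 \<le> total_weight (w k) j" for k
    unfolding total_weight_def by (intro sum_nonneg weight_nonneg) auto
  show "summable (\<lambda>k. mean_cost g k / c)" using assms(2) by (rule summable_divide)
qed

section \<open>Full-dimensional intersections and limit points away from the intersection\<close>

text \<open>
  With a ball inside the intersection the step lengths themselves, not just their squares, are
  summable, so the iterates form a path of finite length.
\<close>

lemma full_dimensional_convergence:
  assumes "full_dimensional (\<Inter>(family C))"
  shows "\<exists>L. x \<longlonglongrightarrow> L \<and>
    (\<forall>j\<ge>1. series_diverges_to_infinity (\<lambda>k. total_weight (w k) j) \<longrightarrow> L \<in> C j)"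
proof -
  obtain T where "int CARD('n) simplex T" "T \<subseteq> \<Inter>(family C)"
    using assms by (auto simp: full_dimensional_def)
  then obtain z where "z \<in> interior (\<Inter>(family C))"
    using simplex_interior_nonempty interior_mono by blast
  then obtain \<rho> where \<rho>: "\<rho> > 0" "cball z \<rho> \<subseteq> \<Inter>(family C)"
    by (meson mem_interior_cball)
  then have z: "z \<in> \<Inter>(family C)" by (meson centre_in_cball less_imp_le subsetD)
  have "summable (mean_cost (\<lambda>t. 2 * \<rho> * t))"
    using \<rho> z by (intro summable_mean_cost[of z] length_fejer) auto
  moreover have "mean_cost (\<lambda>t. 2 * \<rho> * t) = (\<lambda>k. 2 * \<rho> * mean_cost (\<lambda>t. t) k)"
    unfolding mean_cost_def path_cost_scale by (simp add: fun_eq_iff sum_distrib_left mult_ac)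
  ultimately have summable_length: "summable (mean_cost (\<lambda>t. t))"
    using \<rho>(1) summable_mult_D[of "2 * \<rho>" "mean_cost (\<lambda>t. t)"] by simp
  have "dist (x (Suc k)) (x k) \<le> mean_cost (\<lambda>t. t) k + norm (v k)" for k
  proof -
    have "(\<Sum>\<iota>\<in>support (w k). w k \<iota> * dist (proj_seq C \<iota> (x k)) (x k)) \<le> mean_cost (\<lambda>t. t) k"
      unfolding mean_cost_def using dist_proj_seq_le_path_length
      by (intro sum_mono mult_left_mono weight_nonneg) (auto simp: dist_commute)
    then show ?thesis using dist_iterate_le[of k "x k"] by simp
  qed
  then have "summable (\<lambda>k. x (Suc k) - x k)"
    by (intro summable_comparison_test[OF _ summable_add[OF summable_length summable_v]])
       (auto simp: dist_norm)
  then have "(\<lambda>n. \<Sum>k<n. x (Suc k) - x k) \<longlonglongrightarrow> (\<Sum>k. x (Suc k) - x k)"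
    by (rule summable_LIMSEQ)
  then have "(\<lambda>n. x n - x 0 + x 0) \<longlonglongrightarrow> (\<Sum>k. x (Suc k) - x k) + x 0"
    by (intro tendsto_add tendsto_const) (simp add: sum_lessThan_telescope)
  then obtain L where L: "x \<longlonglongrightarrow> L" by auto
  have "L \<in> C j" if j: "j \<ge> 1" "series_diverges_to_infinity (\<lambda>k. total_weight (w k) j)" for j
  proof (rule ccontr)
    assume "L \<notin> C j"
    define c where "c = infdist L (C j)"
    have "c > 0"
      using \<open>L \<notin> C j\<close> infdist_pos_not_in_closed[of "C j" L] closed_C C_nonempty j by (simp add: c_def)
    have "(\<lambda>k. infdist (x k) (C j)) \<longlonglongrightarrow> c"
      unfolding c_def by (intro tendsto_infdist L)
    then have "\<forall>\<^sub>F k in sequentially. infdist (x k) (C j) > c / 2"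
      using \<open>c > 0\<close> by (intro order_tendstoD(1)) auto
    then have "\<forall>\<^sub>F k in sequentially. \<forall>\<iota>\<in>support (w k). j \<in> set \<iota> \<longrightarrow> c / 2 \<le> path_length C \<iota> (x k)"
    proof eventually_elim
      case (elim k)
      then show ?case using infdist_le_path_length support_indices by (meson less_le_trans less_imp_le)
    qed
    then show False
      using total_weight_not_diverges[of "c / 2"] \<open>c > 0\<close> summable_length j by auto
  qed
  then show ?thesis using L by blast
qed

text \<open>
  Index vectors whose sets all contain \<open>p\<close> bring the iterate no farther from \<open>p\<close>. Each other index
  vector moves it to a distance at most \<open>R\<close>, but spends at least the energy \<open>\<eta>\<^sup>2\<close>, so its
  contribution is at most \<open>R / \<eta>\<^sup>2\<close> times that energy.
\<close>

lemma iterate_dist_le_near_far_sets: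
  assumes far: "\<And>i c. 1 \<le> i \<Longrightarrow> p \<notin> C i \<Longrightarrow> c \<in> C i \<Longrightarrow> 2 * \<eta> \<le> dist p c"
    and "\<eta> > 0" "dist (x k) p \<le> \<eta>" and z: "z \<in> \<Inter>(family C)" and R: "dist (x k) z + dist z p \<le> R"
  shows "dist (x (Suc k)) p \<le> dist (x k) p + (R / \<eta>\<^sup>2 * mean_energy k + norm (v k))"
proof -
  have "0 \<le> R" using R zero_le_dist[of "x k" z] zero_le_dist[of z p] by linarith
  have "dist (proj_seq C \<iota> (x k)) p - R / \<eta>\<^sup>2 * path_energy C \<iota> (x k) \<le> dist (x k) p"
    if \<iota>: "\<iota> \<in> support (w k)" for \<iota>
  proof (cases "\<forall>i\<in>set \<iota>. p \<in> C i")
    case True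
    then have "dist (proj_seq C \<iota> (x k)) p \<le> dist (x k) p"
      using support_indices[OF \<iota>] by (intro proj_seq_nonexpansive) auto
    moreover have "0 \<le> R / \<eta>\<^sup>2 * path_energy C \<iota> (x k)"
      using \<open>0 \<le> R\<close> path_cost_nonneg[of "\<lambda>t. t\<^sup>2" C \<iota>] by auto
    ultimately show ?thesis by linarith
  next
    case False
    then obtain j where "j \<in> set \<iota>" "p \<notin> C j" by blast
    then have "\<eta>\<^sup>2 \<le> path_energy C \<iota> (x k)"
      using \<open>\<eta> > 0\<close> assms(3) support_indices[OF \<iota>] by (intro energy_ge_of_far_set[OF far]) auto
    then have "R / \<eta>\<^sup>2 * \<eta>\<^sup>2 \<le> R / \<eta>\<^sup>2 * path_energy C \<iota> (x k)"
      using \<open>0 \<le> R\<close> by (intro mult_left_mono) auto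
    then have "R \<le> R / \<eta>\<^sup>2 * path_energy C \<iota> (x k)" using \<open>\<eta> > 0\<close> by simp
    moreover have "dist (proj_seq C \<iota> (x k)) z \<le> dist (x k) z"
      using support_indices[OF \<iota>] in_C[OF z] by (intro proj_seq_nonexpansive) auto
    then have "dist (proj_seq C \<iota> (x k)) p \<le> R"
      using R dist_triangle[of "proj_seq C \<iota> (x k)" p z] by linarith
    ultimately show ?thesis using zero_le_dist[of "x k" p] by linarith
  qed
  then have "(\<Sum>\<iota>\<in>support (w k). w k \<iota> * (dist (proj_seq C \<iota> (x k)) p - R / \<eta>\<^sup>2 * path_energy C \<iota> (x k)))
    \<le> dist (x k) p" by (rule weighted_sum_le)
  also have "(\<Sum>\<iota>\<in>support (w k). w k \<iota> * (dist (proj_seq C \<iota> (x k)) p - R / \<eta>\<^sup>2 * path_energy C \<iota> (x k)))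
    = (\<Sum>\<iota>\<in>support (w k). w k \<iota> * dist (proj_seq C \<iota> (x k)) p) - R / \<eta>\<^sup>2 * mean_energy k"
    by (simp add: mean_cost_def sum_distrib_left sum_subtractf right_diff_distrib mult_ac)
  finally show ?thesis using dist_iterate_le[of k p] by linarith
qed

lemma cluster_point:
  fixes y :: "nat \<Rightarrow> real ^ 'n"
  assumes "\<And>s. y s \<in> range x"
  obtains L r where "strict_mono r" "(y \<circ> r) \<longlonglongrightarrow> L"
proof -
  have "range y \<subseteq> range x" using assms by blast
  then have "bounded (range y)" by (rule bounded_subset[OF bounded_iterates])
  from bounded_imp_convergent_subsequence[OF this] show ?thesis using that by blast
qed

text \<open>
  Let \<open>p\<close> be a limit point. If it lies in the intersection, quasi-Fejer monotonicity suffices.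
  Otherwise \<open>UASC\<close> keeps all sets missing \<open>p\<close> away from it, so the increments of the distance to
  \<open>p\<close> are summable near \<open>p\<close> and the iterates stay trapped there. An index vector using a set that
  misses \<open>p\<close> then has energy bounded below.
\<close>

lemma UASC_convergence:
  assumes "UASC (family C)"
  shows "\<exists>L. x \<longlonglongrightarrow> L \<and>
    (\<forall>j\<ge>1. series_diverges_to_infinity (\<lambda>k. total_weight (w k) j) \<longrightarrow> L \<in> C j)"
proof -
  obtain p r where r: "strict_mono r" "(x \<circ> r) \<longlonglongrightarrow> p" using cluster_point[of x] by blast
  have close: "\<exists>k\<ge>N. dist (x k) p < \<epsilon>" if "\<epsilon> > 0" for \<epsilon> N
  proof -
    obtain M where "\<And>n. n \<ge> M \<Longrightarrow> dist ((x \<circ> r) n) p < \<epsilon>"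
      using r(2) \<open>\<epsilon> > 0\<close> unfolding LIMSEQ_def by blast
    then have "dist (x (r (max M N))) p < \<epsilon>" by simp
    moreover have "r (max M N) \<ge> N" using seq_suble[OF r(1), of "max M N"] by linarith
    ultimately show ?thesis by blast
  qed
  show ?thesis
  proof (cases "p \<in> \<Inter>(family C)")
    case True
    then have "x \<longlonglongrightarrow> p" using close by (intro tendsto_of_cluster_point)
    then show ?thesis using True in_Inter_family by blast
  next
    case False
    then obtain \<eta> where \<eta>: "\<eta> > 0"
      and far: "\<And>i c. 1 \<le> i \<Longrightarrow> p \<notin> C i \<Longrightarrow> c \<in> C i \<Longrightarrow> 2 * \<eta> \<le> dist p c"
      using UASC_far[OF assms] by metis
    obtain z where z: "z \<in> \<Inter>(family C)" using common_point by blast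
    define R where "R = dist (x 0) z + (\<Sum>k. norm (v k)) + dist z p"
    have R: "dist (x k) z + dist z p \<le> R" for k using dist_bounded[OF z, of k] by (simp add: R_def)
    then have "0 \<le> R" by (meson add_nonneg_nonneg order_trans zero_le_dist)
    have "(\<lambda>k. dist (x k) p) \<longlonglongrightarrow> 0"
    proof (rule tendsto_zero_of_almost_decreasing[of _ "\<lambda>k. R / \<eta>\<^sup>2 * mean_energy k + norm (v k)" \<eta>])
      show "summable (\<lambda>k. R / \<eta>\<^sup>2 * mean_energy k + norm (v k))"
        by (intro summable_add summable_mult summable_mean_energy summable_v)
      show "0 \<le> R / \<eta>\<^sup>2 * mean_energy k + norm (v k)" for k
        using \<open>0 \<le> R\<close> by (intro add_nonneg_nonneg mult_nonneg_nonneg mean_cost_nonneg) auto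
      show "dist (x (Suc k)) p \<le> dist (x k) p + (R / \<eta>\<^sup>2 * mean_energy k + norm (v k))"
        if "dist (x k) p \<le> \<eta>" for k
        using iterate_dist_le_near_far_sets[OF far \<eta> that z R] .
      show "\<exists>k\<ge>N. dist (x k) p < \<epsilon>" if "\<epsilon> > 0" for \<epsilon> N
        using that by (rule close)
    qed (fact \<eta> zero_le_dist)+
    then have "x \<longlonglongrightarrow> p" by (rule tendsto_dist_iff[THEN iffD2])
    then have near: "\<forall>\<^sub>F k in sequentially. dist (x k) p < \<eta>" using \<eta> by (rule tendstoD)
    have "\<not> series_diverges_to_infinity (\<lambda>k. total_weight (w k) j)" if "p \<notin> C j" for j
    proof (rule total_weight_not_diverges)
      show "\<forall>\<^sub>F k in sequentially. \<forall>\<iota>\<in>support (w k). j \<in> set \<iota> \<longrightarrow> \<eta>\<^sup>2 \<le> path_energy C \<iota> (x k)"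
        using near
      proof eventually_elim
        case (elim k)
        show ?case
        proof (intro ballI impI)
          fix \<iota> assume "\<iota> \<in> support (w k)" "j \<in> set \<iota>"
          then show "\<eta>\<^sup>2 \<le> path_energy C \<iota> (x k)"
            using \<eta> elim that by (intro energy_ge_of_far_set[OF far _ _ support_indices]) auto
        qed
      qed
    qed (use \<eta> summable_mean_energy in auto)
    then show ?thesis using \<open>x \<longlonglongrightarrow> p\<close> by blast
  qed
qed

section \<open>Blocks of iterations\<close>

lemma pos_weight_infdist_le_energy:
  "pos_weight (w k) i * (infdist (x k) (C i))\<^sup>2 \<le> mean_energy k"
proof -
  let ?S = "support (w k) \<inter> index_vectors_with i"
  have "pos_weight (w k) i * (infdist (x k) (C i))\<^sup>2
      = (\<Sum>\<iota>\<in>?S. w k \<iota> * ((infdist (x k) (C i))\<^sup>2 / Pos i \<iota>))"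
    by (simp add: pos_weight_def sum_distrib_right)
  also have "\<dots> \<le> (\<Sum>\<iota>\<in>?S. w k \<iota> * path_energy C \<iota> (x k))"
    by (intro sum_mono mult_left_mono infdist_square_le_Pos_energy support_indices weight_nonneg)
       (auto simp: index_vectors_with_def)
  also have "\<dots> \<le> mean_energy k"
    unfolding mean_cost_def
    by (intro sum_mono2 finite_support mult_nonneg_nonneg weight_nonneg path_cost_nonneg) auto
  finally show ?thesis .
qed

text \<open>
  Jensen's inequality for the weights and Cauchy--Schwarz along each broken line, whose
  number of steps is at most \<open>MaxLength\<close>.
\<close>

lemma displacement_le:
  "dist (x (Suc k)) (x k) \<le> sqrt (MaxLength (w k)) * sqrt (mean_energy k) + norm (v k)"
proof -
  let ?S = "support (w k)" and ?M = "real (MaxLength (w k))"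
  let ?a = "\<Sum>\<iota>\<in>?S. w k \<iota> * dist (proj_seq C \<iota> (x k)) (x k)"
  have "?a\<^sup>2 \<le> (\<Sum>\<iota>\<in>?S. w k \<iota> * (dist (proj_seq C \<iota> (x k)) (x k))\<^sup>2)"
    by (intro weighted_mean_square_le weight_nonneg sum_weights)
  also have "\<dots> \<le> (\<Sum>\<iota>\<in>?S. w k \<iota> * (?M * path_energy C \<iota> (x k)))"
  proof (intro sum_mono mult_left_mono weight_nonneg)
    fix \<iota> assume \<iota>: "\<iota> \<in> ?S"
    have "(dist (proj_seq C \<iota> (x k)) (x k))\<^sup>2 \<le> (path_length C \<iota> (x k))\<^sup>2"
      by (subst dist_commute) (intro power_mono dist_proj_seq_le_path_length zero_le_dist)
    also have "\<dots> \<le> length \<iota> * path_energy C \<iota> (x k)" by (rule path_length_square_le)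
    also have "\<dots> \<le> ?M * path_energy C \<iota> (x k)"
      using length_le_MaxLength[OF \<iota>] by (intro mult_right_mono path_cost_nonneg) auto
    finally show "(dist (proj_seq C \<iota> (x k)) (x k))\<^sup>2 \<le> ?M * path_energy C \<iota> (x k)" .
  qed
  also have "\<dots> = ?M * mean_energy k"
    by (simp add: mean_cost_def sum_distrib_left mult_ac)
  finally have "?a \<le> sqrt (?M * mean_energy k)" by (rule real_le_rsqrt)
  then show ?thesis using dist_iterate_le[of k "x k"] by (simp add: real_sqrt_mult)
qed

lemma drift_le:
  assumes "m \<le> n"
  shows "dist (x m) (x n) \<le> sqrt (\<Sum>k\<in>{m..<n}. real (MaxLength (w k))) * sqrt (\<Sum>k\<in>{m..<n}. mean_energy k)
    + (\<Sum>k\<in>{m..<n}. norm (v k))"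
proof -
  have "dist (x m) (x n) \<le> (\<Sum>k\<in>{m..<n}. dist (x (Suc k)) (x k))"
    using assms
  proof (induction n rule: dec_induct)
    case (step n)
    then show ?case using dist_triangle[of "x m" "x (Suc n)" "x n"] by (simp add: dist_commute)
  qed simp
  also have "\<dots> \<le> (\<Sum>k\<in>{m..<n}. sqrt (MaxLength (w k)) * sqrt (mean_energy k))
      + (\<Sum>k\<in>{m..<n}. norm (v k))"
    unfolding sum.distrib[symmetric] by (intro sum_mono displacement_le)
  also have "(\<Sum>k\<in>{m..<n}. sqrt (MaxLength (w k)) * sqrt (mean_energy k))
      \<le> sqrt (\<Sum>k\<in>{m..<n}. real (MaxLength (w k))) * sqrt (\<Sum>k\<in>{m..<n}. mean_energy k)"
    using L2_set_mult_ineq[of "\<lambda>k. sqrt (MaxLength (w k))" "\<lambda>k. sqrt (mean_energy k)" "{m..<n}"]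
    by (simp add: L2_set_def mean_cost_nonneg)
  finally show ?thesis by simp
qed

text \<open>
  At the time \<open>n\<close> in the block where the weight condition for \<open>i\<close> is met, the energy of one step bounds
  the distance to \<open>C i\<close> by \<open>sqrt (E / f)\<close>, with \<open>E\<close> the energy of the block. That time depends on \<open>i\<close>,
  whereas a common limit point needs one time for all indices: the start of the block. Going back
  from \<open>n\<close> to the start costs another \<open>sqrt (E / f)\<close> and the perturbations in between. The length
  condition controls this way back: it runs over iterations before \<open>n\<close> only, hence never over the
  last one of the block.
\<close>

lemma infdist_block_start_le:
  assumes "K < K'" and "f > 0"
    and length: "K' \<ge> K + 2 \<Longrightarrow> (\<Sum>k = K..K' - 2. real (MaxLength (w k))) \<le> 1 / f"
    and weight: "f \<le> Max ((\<lambda>k. pos_weight (w k) i) ` {K..<K'})"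
  shows "infdist (x K) (C i) \<le> 2 * sqrt ((\<Sum>k\<in>{K..<K'}. mean_energy k) / f)
    + (\<Sum>k\<in>{K..<K'}. norm (v k))"
proof -
  define E where "E = (\<Sum>k\<in>{K..<K'}. mean_energy k)"
  have E: "(\<Sum>k\<in>S. mean_energy k) \<le> E" if "S \<subseteq> {K..<K'}" for S
    unfolding E_def using that by (intro sum_mono2 mean_cost_nonneg) auto
  have "Max ((\<lambda>k. pos_weight (w k) i) ` {K..<K'}) \<in> (\<lambda>k. pos_weight (w k) i) ` {K..<K'}"
    using \<open>K < K'\<close> by (intro Max_in) auto
  then obtain n where n: "K \<le> n" "n < K'" "f \<le> pos_weight (w n) i" using weight by auto
  have "f * (infdist (x n) (C i))\<^sup>2 \<le> pos_weight (w n) i * (infdist (x n) (C i))\<^sup>2"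
    using n by (intro mult_right_mono) auto
  also have "\<dots> \<le> mean_energy n" by (rule pos_weight_infdist_le_energy)
  also have "\<dots> \<le> E" using E[of "{n}"] n by simp
  finally have "(infdist (x n) (C i))\<^sup>2 \<le> E / f" using \<open>f > 0\<close> by (simp add: field_simps)
  then have near: "infdist (x n) (C i) \<le> sqrt (E / f)" by (rule real_le_rsqrt)
  have "(\<Sum>k\<in>{K..<n}. real (MaxLength (w k))) \<le> 1 / f"
  proof (cases "K = n")
    case False
    then have "(\<Sum>k\<in>{K..<n}. real (MaxLength (w k))) \<le> (\<Sum>k = K..K' - 2. real (MaxLength (w k)))"
      using n by (intro sum_mono2) auto
    also have "\<dots> \<le> 1 / f" using False n by (intro length) auto
    finally show ?thesis .
  qed (use \<open>f > 0\<close> in simp)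
  then have "sqrt (\<Sum>k\<in>{K..<n}. real (MaxLength (w k))) * sqrt (\<Sum>k\<in>{K..<n}. mean_energy k)
      \<le> sqrt (1 / f) * sqrt E"
    using E[of "{K..<n}"] n \<open>f > 0\<close>
    by (intro mult_mono real_sqrt_le_mono) (auto intro!: sum_nonneg mean_cost_nonneg)
  also have "\<dots> = sqrt (E / f)" by (simp flip: real_sqrt_mult)
  finally have "dist (x K) (x n) \<le> sqrt (E / f) + (\<Sum>k\<in>{K..<n}. norm (v k))"
    using drift_le[OF n(1)] by linarith
  moreover have "(\<Sum>k\<in>{K..<n}. norm (v k)) \<le> (\<Sum>k\<in>{K..<K'}. norm (v k))"
    using n by (intro sum_mono2) auto
  ultimately show ?thesis
    using near infdist_triangle[of "x K" "C i" "x n"] by (simp add: E_def)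
qed

text \<open>
  The block energies are summable and the \<open>f r\<close> are not, so along some sequence of blocks the ratio of
  energy to \<open>f r\<close> tends to \<open>0\<close>. At their starts the iterates approach every \<open>C i\<close>
  simultaneously; any limit point of these lies in the intersection.
\<close>

lemma block_convergence:
  fixes f :: "nat \<Rightarrow> real" and K :: "nat \<Rightarrow> nat"
  assumes "\<And>r. 0 \<le> f r" and "series_diverges_to_infinity f" and mono: "strict_mono K"
    and length: "\<And>r. K (Suc r) \<ge> K r + 2 \<Longrightarrow> f r > 0 \<Longrightarrow>
      (\<Sum>k = K r..K (Suc r) - 2. real (MaxLength (w k))) \<le> 1 / f r"
    and weight: "\<And>i. 1 \<le> i \<Longrightarrow> C i \<noteq> UNIV \<Longrightarrow> \<forall>\<^sub>F r in sequentially.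
      f r \<le> Max ((\<lambda>k. pos_weight (w k) i) ` {K r..<K (Suc r)})"
  shows "\<exists>L\<in>\<Inter>(family C). x \<longlonglongrightarrow> L"
proof -
  define E where "E r = (\<Sum>k\<in>{K r..<K (Suc r)}. mean_energy k)" for r
  define V where "V r = (\<Sum>k\<in>{K r..<K (Suc r)}. norm (v k))" for r
  have "summable E"
    unfolding E_def by (intro summable_block_sums mono summable_mean_energy mean_cost_nonneg) auto
  moreover have "0 \<le> E r" for r unfolding E_def by (intro sum_nonneg mean_cost_nonneg) auto
  ultimately have "\<exists>r\<ge>s. f r > 0 \<and> E r \<le> inverse (real (Suc s)) * f r" for s
    using assms(1,2) by (intro frequently_summable_le_diverging) auto
  then obtain r where r: "\<And>s. s \<le> r s" "\<And>s. f (r s) > 0"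
      "\<And>s. E (r s) \<le> inverse (real (Suc s)) * f (r s)"
    by metis
  have r_at_top: "filterlim r at_top sequentially"
    by (rule filterlim_at_top_mono[OF filterlim_ident]) (use r(1) in auto)
  have "summable V" unfolding V_def by (intro summable_block_sums mono summable_v) auto
  then have V0: "(\<lambda>s. V (r s)) \<longlonglongrightarrow> 0"
    using summable_LIMSEQ_zero filterlim_compose r_at_top by blast
  define b where "b s = 2 * sqrt (inverse (real (Suc s))) + V (r s)" for s
  have "b \<longlonglongrightarrow> 2 * sqrt 0 + 0"
    unfolding b_def by (intro tendsto_intros V0 LIMSEQ_inverse_real_of_nat)
  then have b0: "b \<longlonglongrightarrow> 0" by simp
  have close: "\<forall>\<^sub>F s in sequentially. infdist (x (K (r s))) (C i) \<le> b s"
    if "1 \<le> i" "C i \<noteq> UNIV" for i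
    using eventually_compose_filterlim[OF weight[OF that] r_at_top]
  proof eventually_elim
    case (elim s)
    have "infdist (x (K (r s))) (C i) \<le> 2 * sqrt (E (r s) / f (r s)) + V (r s)"
      unfolding E_def V_def
      by (intro infdist_block_start_le r length elim) (use mono in \<open>auto simp: strict_mono_less\<close>)
    also have "\<dots> \<le> b s"
      using r(2,3)[of s] by (simp add: b_def field_simps)
    finally show ?case .
  qed
  obtain L h where h: "strict_mono h" "(\<lambda>s. x (K (r (h s)))) \<longlonglongrightarrow> L"
    by (rule cluster_point[of "\<lambda>s. x (K (r s))", OF rangeI, unfolded comp_def])
  have h_at_top: "filterlim h at_top sequentially" using h(1) by (rule filterlim_subseq)
  have "L \<in> C i" if i: "1 \<le> i" for i
  proof (cases "C i = UNIV")
    case False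
    have lim: "(\<lambda>s. infdist (x (K (r (h s)))) (C i)) \<longlonglongrightarrow> infdist L (C i)"
      by (intro tendsto_infdist h(2))
    have bound: "(\<lambda>s. b (h s)) \<longlonglongrightarrow> 0" by (rule filterlim_compose[OF b0 h_at_top])
    have "\<forall>\<^sub>F s in sequentially. infdist (x (K (r (h s)))) (C i) \<le> b (h s)"
      using eventually_compose_filterlim[OF close[OF i False] h_at_top] .
    then have "infdist L (C i) \<le> 0"
      by (rule tendsto_le[OF trivial_limit_sequentially bound lim])
    then have "infdist L (C i) = 0" using infdist_nonneg[of L "C i"] by linarith
    then show ?thesis
      using in_closed_iff_infdist_zero[OF closed_C[OF i] C_nonempty[OF i]] by blast
  qed simp
  then have L: "L \<in> \<Inter>(family C)" using in_Inter_family by blast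
  have "\<exists>k\<ge>N. dist (x k) L < \<epsilon>" if "\<epsilon> > 0" for \<epsilon> N
  proof -
    obtain M where M: "\<And>s. s \<ge> M \<Longrightarrow> dist (x (K (r (h s)))) L < \<epsilon>"
      using h(2) \<open>\<epsilon> > 0\<close> unfolding LIMSEQ_def by blast
    define s where "s = max M N"
    have "s \<le> h s" "h s \<le> r (h s)" "r (h s) \<le> K (r (h s))"
      using h(1) mono r(1) by (auto intro: seq_suble)
    then have "N \<le> K (r (h s))" by (simp add: s_def)
    then show ?thesis using M[of s] by (auto simp: s_def)
  qed
  then show ?thesis using L tendsto_of_cluster_point by blast
qed

end

section \<open>Convergence of the perturbed iteration\<close>

theorem theorem5p1:
  fixes C :: "nat \<Rightarrow> (real ^ 'n) set"
    and w :: "nat \<Rightarrow> nat list \<Rightarrow> real"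
    and v x :: "nat \<Rightarrow> real ^ 'n"
  assumes "\<And>i. 1 \<le> i \<Longrightarrow> closed (C i)"
    and "\<And>i. 1 \<le> i \<Longrightarrow> convex (C i)"
    and "\<Inter>(family C) \<noteq> {}"
    and "\<exists>i\<ge>1. C i \<noteq> UNIV"
    and "\<And>k. weight_function (w k)"
    and "\<And>k. x (Suc k) = (\<Sum>\<iota>\<in>support (w k). w k \<iota> *\<^sub>R proj_seq C \<iota> (x k)) + v k"
    and "summable (\<lambda>k. norm (v k))"
  shows
    "(full_dimensional (\<Inter>(family C)) \<or> UASC (family C) \<longrightarrow>
        (\<exists>L. x \<longlonglongrightarrow> L \<and>
          (\<forall>j\<ge>1. series_diverges_to_infinity (\<lambda>k. total_weight (w k) j) \<longrightarrow> L \<in> C j)))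
     \<and>
     ((full_dimensional (\<Inter>(family C)) \<or> UASC (family C)) \<and>
        (\<forall>j\<ge>1. C j \<noteq> UNIV \<longrightarrow> series_diverges_to_infinity (\<lambda>k. total_weight (w k) j)) \<longrightarrow>
        (\<exists>L \<in> \<Inter>(family C). x \<longlonglongrightarrow> L))
     \<and>
     ((\<exists>(f :: nat \<Rightarrow> real) (\<kappa> :: nat \<Rightarrow> nat).
          (\<forall>r\<ge>1. 0 \<le> f r \<and> f r \<le> 1) \<and>
          series_diverges_to_infinity (\<lambda>r. f (Suc r)) \<and>
          strict_mono_on {1..} \<kappa> \<and>
          (\<forall>r\<ge>1. \<kappa> (r + 1) \<ge> \<kappa> r + 2 \<and> f r > 0 \<longrightarrow>
             (\<Sum>k = \<kappa> r..\<kappa> (r + 1) - 2. real (MaxLength (w k))) \<le> 1 / f r) \<and>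
          (\<forall>i\<ge>1. C i \<noteq> UNIV \<longrightarrow>
             (\<forall>\<^sub>F r in sequentially.
                f r \<le> Max ((\<lambda>k. pos_weight (w k) i) ` {\<kappa> r..<\<kappa> (r + 1)})))) \<longrightarrow>
        (\<exists>L \<in> \<Inter>(family C). x \<longlonglongrightarrow> L))"
    (is "(?regular \<longrightarrow> ?limit) \<and> (?regular \<and> ?all \<longrightarrow> ?common) \<and> (?blocks \<longrightarrow> ?common)")
proof -
  interpret perturbed_projections C w v x
    by unfold_locales fact+
  have part1: "?regular \<longrightarrow> ?limit"
    using full_dimensional_convergence UASC_convergence by blast
  moreover have "?common" if "?regular" "?all"
  proof -
    obtain L where L: "x \<longlonglongrightarrow> L"
      "\<And>j. j \<ge> 1 \<Longrightarrow> series_diverges_to_infinity (\<lambda>k. total_weight (w k) j) \<Longrightarrow> L \<in> C j"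
      using part1 \<open>?regular\<close> by blast
    have "L \<in> C j" if "j \<ge> 1" for j
      using L(2) \<open>?all\<close> that by (cases "C j = UNIV") auto
    then show ?thesis using L(1) in_Inter_family by blast
  qed
  moreover have "?common" if blocks: "?blocks"
  proof -
    obtain f \<kappa> where f: "\<And>r. r \<ge> 1 \<Longrightarrow> 0 \<le> f r" "series_diverges_to_infinity (\<lambda>r. f (Suc r))"
      and \<kappa>: "strict_mono_on {1..} \<kappa>"
      and length: "\<And>r. r \<ge> 1 \<Longrightarrow> \<kappa> (r + 1) \<ge> \<kappa> r + 2 \<Longrightarrow> f r > 0 \<Longrightarrow>
        (\<Sum>k = \<kappa> r..\<kappa> (r + 1) - 2. real (MaxLength (w k))) \<le> 1 / f r"
      and weight: "\<And>i. i \<ge> 1 \<Longrightarrow> C i \<noteq> UNIV \<Longrightarrow> \<forall>\<^sub>F r in sequentially.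
        f r \<le> Max ((\<lambda>k. pos_weight (w k) i) ` {\<kappa> r..<\<kappa> (r + 1)})"
      using blocks by blast
    (* blocks are numbered from 1, the values of f and \<kappa> at 0 are arbitrary: shift everything by one *)
    show ?thesis
    proof (rule block_convergence[of "\<lambda>r. f (Suc r)" "\<lambda>r. \<kappa> (Suc r)"])
      show "strict_mono (\<lambda>r. \<kappa> (Suc r))"
        using \<kappa> by (auto simp: strict_mono_on_def strict_mono_def)
      show "\<forall>\<^sub>F r in sequentially.
          f (Suc r) \<le> Max ((\<lambda>k. pos_weight (w k) i) ` {\<kappa> (Suc r)..<\<kappa> (Suc (Suc r))})"
        if "1 \<le> i" "C i \<noteq> UNIV" for i
        using weight[OF that] eventually_sequentially_Suc[of
          "\<lambda>r. f r \<le> Max ((\<lambda>k. pos_weight (w k) i) ` {\<kappa> r..<\<kappa> (Suc r)})"] by simp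
      show "(\<Sum>k = \<kappa> (Suc r)..\<kappa> (Suc (Suc r)) - 2. real (MaxLength (w k))) \<le> 1 / f (Suc r)"
        if "\<kappa> (Suc (Suc r)) \<ge> \<kappa> (Suc r) + 2" "f (Suc r) > 0" for r
        using length[of "Suc r"] that by simp
    qed (use f in auto)
  qed
  ultimately show ?thesis by blast
qed

end
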